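(* Every module over the twisted skew brace algebra $\mathbb{C}B_{\oplus,\odot}$ of a finite skew left brace $B$ can be regarded as a module over the semidirect product $G=[K]C$ of the additive group $K=(B,+)$ and the multiplicative group $C=(B,\cdot)$ (the semidirect product being taken with respect to the lambda action of $C$ on $K$).
   Context: A skew left brace is a triple $(B,+,\cdot)$ where $(B,+)$ and $(B,\cdot)$ are groups such that $a(b+c)=ab-a+ac$ for all $a,b,c\in B$. The lambda action is the group homomorphism $\lambda\colon C\to\operatorname{Aut}(K)$, $c\mapsto\lambda_c$, with $\lambda_c(b)=-c+cb$. In $G=[K]C$ the normal subgroup $K$ is written multiplicatively, every element is uniquely of the form $kc$ with $k\in K$, $c\in C$, and $(k_1c_1)(k_2c_2)=(k_1\lambda_{c_1}(k_2))(c_1c_2)$. A module over the group $G$ means a complex vector space with a linear action of $G$, that is, a $\mathbb{C}G$-module. The twisted skew brace algebra $\mathbb{C}B_{\oplus,\odot}$ of $B$ (for the trivial $2$-cocycle) is the complex vector space $\mathbb{C}B$ with basis $\{e_b\mid b\in B\}$, endowed with two algebra products $\oplus$ and $\odot$, the bilinear extensions of $e_a\oplus e_b=e_{a+b}$ and $e_a\odot e_b=e_{ab}$. A module over $\mathbb{C}B_{\oplus,\odot}$ is a $\mathbb{C}$-vector space $V$ together with two (unital) algebra homomorphisms $\hat\rho\colon(\mathbb{C}B,\oplus)\to\operatorname{End}(V)$ and $\hat\beta\colon(\mathbb{C}B,\odot)\to\operatorname{End}(V)$ (where $\oplus$, respectively $\odot$, is the product of the algebra) satisfying $\hat\rho(e_a\odot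 e_b)=\hat\beta(e_a)\hat\rho(e_b)\hat\beta(e_a)^{-1}\hat\rho(e_a)$ for all $a,b\in B$. *)

theory Defs
  imports
    Complex_Main
    "HOL-Library.Poly_Mapping"
    "HOL-Algebra.Group_Action"
    "HOL-Algebra.Ring"
begin

text \<open>
  A skew left brace is carried by a ring record: \<open>add_monoid B\<close> is the (not necessarily
  abelian) group \<open>(B,+)\<close>, and the multiplicative part of the record is the group \<open>(B,\<cdot>)\<close>.
\<close>

locale skew_left_brace =
  add: group "add_monoid B" + mult: group B for B (structure) +
  assumes brace_distrib:
    "\<lbrakk>a \<in> carrier B; b \<in> carrier B; c \<in> carrier B\<rbrakk>
      \<Longrightarrow> a \<otimes> (b \<oplus> c) = a \<otimes> b \<oplus> (\<ominus> a) \<oplus> a \<otimes> c"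

definition brace_lambda :: "('b, 'm) ring_scheme \<Rightarrow> 'b \<Rightarrow> 'b \<Rightarrow> 'b" where
  "brace_lambda B c b = (\<ominus>\<^bsub>B\<^esub> c) \<oplus>\<^bsub>B\<^esub> (c \<otimes>\<^bsub>B\<^esub> b)"

text \<open>The element \<open>kc\<close> of \<open>[K]C\<close> is represented by the pair \<open>(k, c)\<close>.\<close>

definition semidirect_product ::
  "('k, 'm) monoid_scheme \<Rightarrow> ('c, 'n) monoid_scheme \<Rightarrow> ('c \<Rightarrow> 'k \<Rightarrow> 'k) \<Rightarrow> ('k \<times> 'c) monoid" where
  "semidirect_product K C \<phi> =
    \<lparr>carrier = carrier K \<times> carrier C,
     mult = (\<lambda>(k\<^sub>1, c\<^sub>1) (k\<^sub>2, c\<^sub>2). (k\<^sub>1 \<otimes>\<^bsub>K\<^esub> \<phi> c\<^sub>1 k\<^sub>2, c\<^sub>1 \<otimes>\<^bsub>C\<^esub> c\<^sub>2)),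
     one = (\<one>\<^bsub>K\<^esub>, \<one>\<^bsub>C\<^esub>)\<rparr>"

definition brace_semidirect :: "('b, 'm) ring_scheme \<Rightarrow> ('b \<times> 'b) monoid" where
  "brace_semidirect B = semidirect_product (add_monoid B) B (brace_lambda B)"

text \<open>
  The vector space with basis \<open>carrier G\<close> consists of the finitely supported functions whose
  support lies in \<open>carrier G\<close>. The basis vector indexed by \<open>a\<close> is \<open>alg_basis a\<close>.
\<close>

definition alg_basis :: "'b \<Rightarrow> ('b \<Rightarrow>\<^sub>0 complex)" where
  "alg_basis a = Poly_Mapping.single a 1"

definition alg_carrier :: "('b, 'm) monoid_scheme \<Rightarrow> ('b \<Rightarrow>\<^sub>0 complex) set" where
  "alg_carrier G = {x. Poly_Mapping.keys x \<subseteq> carrier G}"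

definition alg_scale :: "complex \<Rightarrow> ('b \<Rightarrow>\<^sub>0 complex) \<Rightarrow> ('b \<Rightarrow>\<^sub>0 complex)" where
  "alg_scale z x = Poly_Mapping.map (\<lambda>t. z * t) x"

text \<open>The bilinear extension of the group operation on basis vectors.\<close>

definition alg_mult ::
  "('b, 'm) monoid_scheme \<Rightarrow> ('b \<Rightarrow>\<^sub>0 complex) \<Rightarrow> ('b \<Rightarrow>\<^sub>0 complex) \<Rightarrow> ('b \<Rightarrow>\<^sub>0 complex)" where
  "alg_mult G x y =
    (\<Sum>a\<in>Poly_Mapping.keys x. \<Sum>b\<in>Poly_Mapping.keys y.
      alg_scale (Poly_Mapping.lookup x a * Poly_Mapping.lookup y b) (alg_basis (a \<otimes>\<^bsub>G\<^esub> b)))"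

text \<open>A unital algebra homomorphism from the group algebra of \<open>G\<close> to \<open>End(V)\<close>.\<close>

locale alg_hom_End =
  vector_space scale
  for G :: "('b, 'm) monoid_scheme" (structure)
    and scale :: "complex \<Rightarrow> 'v::ab_group_add \<Rightarrow> 'v"
    and h :: "('b \<Rightarrow>\<^sub>0 complex) \<Rightarrow> 'v \<Rightarrow> 'v" +
  assumes hom_End: "x \<in> alg_carrier G \<Longrightarrow> Vector_Spaces.linear scale scale (h x)"
    and hom_add: "\<lbrakk>x \<in> alg_carrier G; y \<in> alg_carrier G\<rbrakk> \<Longrightarrow> h (x + y) = (\<lambda>v. h x v + h y v)"
    and hom_scale: "x \<in> alg_carrier G \<Longrightarrow> h (alg_scale z x) = (\<lambda>v. scale z (h x v))"
    and hom_mult: "\<lbrakk>x \<in> alg_carrier G; y \<in> alg_carrier G\<rbrakk> \<Longrightarrow> h (alg_mult G x y) = h x \<circ> h y"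
    and hom_one: "h (alg_basis \<one>) = id"

text \<open>
  A module over the twisted skew brace algebra. The product \<open>\<oplus>\<close> of the algebra is
  \<open>alg_mult (add_monoid B)\<close> and \<open>\<odot>\<close> is \<open>alg_mult B\<close>; the inverse of \<open>\<beta> e\<^sub>a\<close> is that of a
  bijection of \<open>V\<close>.
\<close>

locale twisted_brace_module =
  skew_left_brace B + \<rho>: alg_hom_End "add_monoid B" scale \<rho> + \<beta>: alg_hom_End B scale \<beta>
  for B :: "('b, 'm) ring_scheme" (structure)
    and scale :: "complex \<Rightarrow> 'v::ab_group_add \<Rightarrow> 'v"
    and \<rho> \<beta> :: "('b \<Rightarrow>\<^sub>0 complex) \<Rightarrow> 'v \<Rightarrow> 'v" +
  assumes twisted_rel:
    "\<lbrakk>a \<in> carrier B; b \<in> carrier B\<rbrakk> \<Longrightarrow>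
      \<rho> (alg_mult B (alg_basis a) (alg_basis b)) =
        \<beta> (alg_basis a) \<circ> \<rho> (alg_basis b) \<circ> inv_into UNIV (\<beta> (alg_basis a)) \<circ> \<rho> (alg_basis a)"

text \<open>A complex vector space with a linear action of the group \<open>G\<close>.\<close>

definition linear_group_action ::
  "('g, 'm) monoid_scheme \<Rightarrow> (complex \<Rightarrow> 'v::ab_group_add \<Rightarrow> 'v) \<Rightarrow> ('g \<Rightarrow> 'v \<Rightarrow> 'v) \<Rightarrow> bool" where
  "linear_group_action G scale \<sigma> \<longleftrightarrow>
    vector_space scale \<and> group_action G UNIV \<sigma> \<and>
    (\<forall>g\<in>carrier G. Vector_Spaces.linear scale scale (\<sigma> g))"

text \<open>
  The action \<open>\<sigma>\<close> of \<open>G = [K]C\<close> encodes the module structure \<open>(\<rho>, \<beta>)\<close>: \<open>\<rho>\<close> is the restriction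
  of \<open>\<sigma>\<close> to \<open>K\<close>, and \<open>\<beta>\<close> is the restriction of \<open>\<sigma>\<close> to \<open>{cc | c \<in> C}\<close>, the image of \<open>C\<close> under
  the embedding \<open>c \<mapsto> (c, c)\<close> into \<open>G\<close> (a homomorphism, as \<open>a + \<lambda>\<^sub>a(b) = ab\<close>). Equivalently
  \<open>\<sigma>(kc) = \<rho>(e\<^sub>k) \<rho>(e\<^sub>c)\<^sup>-\<^sup>1 \<beta>(e\<^sub>c)\<close>. The restriction of \<open>\<sigma>\<close> to the complement \<open>{(0, c)}\<close> cannot
  be \<open>\<beta>\<close> in general: the twisted relation says that \<open>\<beta>(e\<^sub>a)\<close> conjugates \<open>\<rho>(e\<^sub>b)\<close> to
  \<open>\<rho>(e\<^bsub>ab-a\<^esub>)\<close>, and \<open>ab - a\<close> differs from \<open>\<lambda>\<^sub>a(b) = -a + ab\<close> when \<open>(B,+)\<close> is not abelian.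
\<close>

definition encodes_brace_module ::
  "('b, 'm) ring_scheme \<Rightarrow> ('b \<times> 'b \<Rightarrow> 'v \<Rightarrow> 'v) \<Rightarrow>
    (('b \<Rightarrow>\<^sub>0 complex) \<Rightarrow> 'v \<Rightarrow> 'v) \<Rightarrow> (('b \<Rightarrow>\<^sub>0 complex) \<Rightarrow> 'v \<Rightarrow> 'v) \<Rightarrow> bool" where
  "encodes_brace_module B \<sigma> \<rho> \<beta> \<longleftrightarrow>
    (\<forall>k\<in>carrier B. \<sigma> (k, \<one>\<^bsub>B\<^esub>) = \<rho> (alg_basis k)) \<and>
    (\<forall>c\<in>carrier B. \<sigma> (c, c) = \<beta> (alg_basis c))"

end

theory Submission
  imports Defs
begin

text \<open>
  Write \<open>\<rho>\<^sub>k\<close> and \<open>\<beta>\<^sub>c\<close> for the images of the basis vectors. The twisted relation says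
  \<open>\<beta>\<^sub>a \<rho>\<^sub>b = \<rho>(ab - a) \<beta>\<^sub>a\<close>. In \<open>[K]C\<close> one has \<open>(k, c) = (k - c, 1)(c, c)\<close>, which forces
  \<open>\<sigma>(k, c) = \<rho>(k - c) \<beta>\<^sub>c\<close>. This is multiplicative because the brace identity gives
  \<open>a(b - c) - a = ab - ac\<close>.
\<close>

lemma semidirect_product_group:
  assumes "group K" and "group C"
    and closed: "\<And>c k. \<lbrakk>c \<in> carrier C; k \<in> carrier K\<rbrakk> \<Longrightarrow> \<phi> c k \<in> carrier K"
    and hom: "\<And>c k l. \<lbrakk>c \<in> carrier C; k \<in> carrier K; l \<in> carrier K\<rbrakk>
      \<Longrightarrow> \<phi> c (k \<otimes>\<^bsub>K\<^esub> l) = \<phi> c k \<otimes>\<^bsub>K\<^esub> \<phi> c l"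
    and one: "\<And>k. k \<in> carrier K \<Longrightarrow> \<phi> \<one>\<^bsub>C\<^esub> k = k"
    and mult: "\<And>c d k. \<lbrakk>c \<in> carrier C; d \<in> carrier C; k \<in> carrier K\<rbrakk>
      \<Longrightarrow> \<phi> (c \<otimes>\<^bsub>C\<^esub> d) k = \<phi> c (\<phi> d k)"
  shows "group (semidirect_product K C \<phi>)"
proof -
  interpret K: group K by fact
  interpret C: group C by fact
  have hom_one: "\<phi> c \<one>\<^bsub>K\<^esub> = \<one>\<^bsub>K\<^esub>" if "c \<in> carrier C" for c
  proof -
    \<comment> \<open>The image of the identity is idempotent, and the only idempotent of a group is
      its identity.\<close>
    have "\<phi> c \<one>\<^bsub>K\<^esub> \<otimes>\<^bsub>K\<^esub> \<phi> c \<one>\<^bsub>K\<^esub> = \<phi> c \<one>\<^bsub>K\<^esub>"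
      using hom[of c "\<one>\<^bsub>K\<^esub>" "\<one>\<^bsub>K\<^esub>"] that by simp
    then show ?thesis
      using closed[of c "\<one>\<^bsub>K\<^esub>"] that by simp
  qed
  show ?thesis
  proof (rule groupI)
    fix x assume "x \<in> carrier (semidirect_product K C \<phi>)"
    then obtain k c where x: "x = (k, c)" "k \<in> carrier K" "c \<in> carrier C"
      by (auto simp: semidirect_product_def)
    \<comment> \<open>\<open>groupI\<close> asks only for a left inverse. Solving for it in [K]C
      gives c^-1 as second component; the first must cancel the image of k under the action of c^-1,
      so it is the image of k^-1 under that action.\<close>
    let ?y = "(\<phi> (inv\<^bsub>C\<^esub> c) (inv\<^bsub>K\<^esub> k), inv\<^bsub>C\<^esub> c)"
    have "\<phi> (inv\<^bsub>C\<^esub> c) (inv\<^bsub>K\<^esub> k) \<otimes>\<^bsub>K\<^esub> \<phi> (inv\<^bsub>C\<^esub> c) k = \<one>\<^bsub>K\<^esub>"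
      using x hom[of "inv\<^bsub>C\<^esub> c" "inv\<^bsub>K\<^esub> k" k] by (simp add: hom_one)
    then have "?y \<in> carrier (semidirect_product K C \<phi>) \<and>
        ?y \<otimes>\<^bsub>semidirect_product K C \<phi>\<^esub> x = \<one>\<^bsub>semidirect_product K C \<phi>\<^esub>"
      using x by (auto simp: semidirect_product_def closed)
    then show "\<exists>y\<in>carrier (semidirect_product K C \<phi>).
        y \<otimes>\<^bsub>semidirect_product K C \<phi>\<^esub> x = \<one>\<^bsub>semidirect_product K C \<phi>\<^esub>"
      by blast
  qed (auto simp: semidirect_product_def closed hom one mult K.m_assoc C.m_assoc)
qed

context skew_left_brace
begin

text \<open>Facts about the group \<open>add_monoid B\<close> are restated in ring notation; folding
  \<open>a_inv_def\<close> turns its inverse into the unary minus of the record.\<close>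

lemmas plus_closed = add.m_closed[simplified]
lemmas plus_assoc = add.m_assoc[simplified]
lemmas zero_closed = add.one_closed[simplified]
lemmas plus_zero = add.l_one[simplified] add.r_one[simplified]
lemmas minus_closed = add.inv_closed[simplified, folded a_inv_def]
lemmas plus_minus = add.l_inv[simplified, folded a_inv_def] add.r_inv[simplified, folded a_inv_def]
lemmas minus_minus = add.inv_inv[simplified, folded a_inv_def]
lemmas minus_plus = add.inv_mult_group[simplified, folded a_inv_def]

lemmas plus_simps = plus_closed plus_assoc zero_closed plus_zero minus_closed plus_minus
  minus_minus minus_plus

lemma plus_minus_cancel:
  assumes "a \<in> carrier B" and "b \<in> carrier B"
  shows "a \<oplus> ((\<ominus> a) \<oplus> b) = b" and "(\<ominus> a) \<oplus> (a \<oplus> b) = b"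
  using assms by (simp_all add: plus_simps flip: plus_assoc)

lemma plus_left_cancel:
  "\<lbrakk>a \<in> carrier B; b \<in> carrier B; c \<in> carrier B; a \<oplus> b = a \<oplus> c\<rbrakk> \<Longrightarrow> b = c"
  by (metis plus_minus_cancel(2))

text \<open>Expanding a(0 + 0) by the brace identity gives a0 = a0 - a + a0, and cancelling a0 on
  the left leaves 0 = -a + a0.\<close>

lemma mult_zero:
  assumes "a \<in> carrier B"
  shows "a \<otimes> \<zero> = a"
proof -
  have c: "a \<otimes> \<zero> \<in> carrier B"
    using assms by (simp add: zero_closed)
  have "a \<otimes> \<zero> \<oplus> \<zero> = a \<otimes> \<zero> \<oplus> ((\<ominus> a) \<oplus> a \<otimes> \<zero>)"
    using brace_distrib[of a \<zero> \<zero>] assms c by (simp add: plus_simps)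
  then have "\<zero> = (\<ominus> a) \<oplus> a \<otimes> \<zero>"
    by (rule plus_left_cancel[rotated 3]) (use assms c in \<open>simp_all add: plus_simps\<close>)
  then show ?thesis
    using assms c plus_minus_cancel(1)[of a "a \<otimes> \<zero>"] by (simp add: plus_simps)
qed

text \<open>Both groups share their identity: 1 = 1 * 0 = 0, by \<open>mult_zero\<close> at a =
  1.\<close>

lemma one_eq_zero: "\<one> = \<zero>"
  using mult_zero[of \<one>] by (simp add: zero_closed)

lemma minus_one: "\<ominus> \<one> = \<zero>"
  using plus_minus(1)[of \<zero>] plus_zero(2)[of "\<ominus> \<zero>"]
  by (simp add: one_eq_zero zero_closed minus_closed)

lemma brace_lambda_closed:
  "\<lbrakk>c \<in> carrier B; b \<in> carrier B\<rbrakk> \<Longrightarrow> brace_lambda B c b \<in> carrier B"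
  by (simp add: brace_lambda_def plus_simps)

lemma plus_brace_lambda:
  "\<lbrakk>c \<in> carrier B; b \<in> carrier B\<rbrakk> \<Longrightarrow> c \<oplus> brace_lambda B c b = c \<otimes> b"
  by (simp add: brace_lambda_def plus_minus_cancel)

text \<open>Regrouping -c + (ca - c + cb) as (-c + ca) + (-c + cb) gives the claim; commutativity of
  addition does not enter.\<close>

lemma brace_lambda_plus:
  "\<lbrakk>c \<in> carrier B; a \<in> carrier B; b \<in> carrier B\<rbrakk>
    \<Longrightarrow> brace_lambda B c (a \<oplus> b) = brace_lambda B c a \<oplus> brace_lambda B c b"
  by (simp add: brace_lambda_def brace_distrib plus_simps)

lemma brace_lambda_one: "b \<in> carrier B \<Longrightarrow> brace_lambda B \<one> b = b"
  by (simp add: brace_lambda_def minus_one plus_zero)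

lemma brace_lambda_mult:
  assumes "a \<in> carrier B" and "b \<in> carrier B" and "c \<in> carrier B"
  shows "brace_lambda B (a \<otimes> b) c = brace_lambda B a (brace_lambda B b c)"
proof (rule plus_left_cancel)
  \<comment> \<open>With ab added on the left, both sides become abc. Here bc is written as b +
    \<lambda>_b(c), so that the brace identity can split the product with a.\<close>
  have "a \<otimes> b \<oplus> brace_lambda B (a \<otimes> b) c = a \<otimes> (b \<oplus> brace_lambda B b c)"
    using assms by (simp add: plus_brace_lambda mult.m_assoc)
  also have "\<dots> = a \<otimes> b \<oplus> brace_lambda B a (brace_lambda B b c)"
    using assms brace_lambda_closed[of b c]
    \<comment> \<open>Only the outer map, at a, is unfolded: ax = a + \<lambda>_a(x) is applied to x
      = \<lambda>_b(c), which stays opaque.\<close>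
    by (simp add: brace_distrib plus_assoc plus_closed minus_closed brace_lambda_def[of B a])
  finally show "a \<otimes> b \<oplus> brace_lambda B (a \<otimes> b) c
      = a \<otimes> b \<oplus> brace_lambda B a (brace_lambda B b c)" .
qed (use assms in \<open>simp_all add: brace_lambda_closed\<close>)

lemma group_brace_semidirect: "group (brace_semidirect B)"
  unfolding brace_semidirect_def
  by (rule semidirect_product_group)
     (simp_all add: add.is_group mult.is_group brace_lambda_closed brace_lambda_plus
       brace_lambda_one brace_lambda_mult)

text \<open>Expand ab = a((b - c) + c) by the brace identity and move the last summand ac to the
  other side.\<close>

lemma mult_minus:
  assumes "a \<in> carrier B" and "b \<in> carrier B" and "c \<in> carrier B"
  shows "a \<otimes> (b \<oplus> (\<ominus> c)) \<oplus> (\<ominus> a) = a \<otimes> b \<oplus> (\<ominus> (a \<otimes> c))"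
proof -
  have "a \<otimes> b = a \<otimes> ((b \<oplus> (\<ominus> c)) \<oplus> c)"
    using assms by (simp add: plus_simps)
  also have "\<dots> = a \<otimes> (b \<oplus> (\<ominus> c)) \<oplus> (\<ominus> a) \<oplus> a \<otimes> c"
    using assms by (intro brace_distrib) (simp_all add: plus_closed minus_closed)
  finally show ?thesis
    using assms by (simp add: plus_simps)
qed

end

lemma alg_basis_in_alg_carrier: "a \<in> carrier G \<Longrightarrow> alg_basis a \<in> alg_carrier G"
  by (simp add: alg_basis_def alg_carrier_def)

lemma alg_mult_basis: "alg_mult G (alg_basis a) (alg_basis b) = alg_basis (a \<otimes>\<^bsub>G\<^esub> b)"
  by (simp add: alg_mult_def alg_basis_def alg_scale_def)

context alg_hom_End
begin

lemma basis_mult: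
  "\<lbrakk>a \<in> carrier G; b \<in> carrier G\<rbrakk>
    \<Longrightarrow> h (alg_basis a) \<circ> h (alg_basis b) = h (alg_basis (a \<otimes> b))"
  by (simp add: alg_basis_in_alg_carrier flip: hom_mult alg_mult_basis)

lemma basis_linear: "a \<in> carrier G \<Longrightarrow> Vector_Spaces.linear scale scale (h (alg_basis a))"
  by (simp add: alg_basis_in_alg_carrier hom_End)

text \<open>The basis vector at the group inverse of a yields the two-sided inverse map. Thus
  \<open>inv_into UNIV\<close> in the twisted relation is a genuine inverse.\<close>

lemma basis_bij:
  assumes "group G" and "a \<in> carrier G"
  shows "bij (h (alg_basis a))"
proof -
  interpret G: group G by fact
  show ?thesis
    using basis_mult[of a "inv a"] basis_mult[of "inv a" a] assms(2)
    by (intro o_bij[of "h (alg_basis (inv a))"]) (simp_all add: hom_one)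
qed

end

context twisted_brace_module
begin

text \<open>Composing \<open>twisted_rel\<close> on the right with \<rho>(-a) removes its trailing
  factor \<rho>(a); composing then with \<beta>(a) removes the inverse.\<close>

lemma beta_rho:
  assumes a: "a \<in> carrier B" and b: "b \<in> carrier B"
  shows "\<beta> (alg_basis a) \<circ> \<rho> (alg_basis b)
    = \<rho> (alg_basis (a \<otimes> b \<oplus> (\<ominus> a))) \<circ> \<beta> (alg_basis a)"
proof -
  let ?A = "\<beta> (alg_basis a)" and ?R = "\<lambda>x. \<rho> (alg_basis x)"
  have inv: "inv_into UNIV ?A \<circ> ?A = id"
    using \<beta>.basis_bij[OF mult.is_group a] by (simp add: bij_is_inj)
  have R: "?R x \<circ> ?R y = ?R (x \<oplus> y)" if "x \<in> carrier B" "y \<in> carrier B" for x y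
    using \<rho>.basis_mult[of x y] that by simp
  have R0: "?R \<zero> = id"
    using \<rho>.hom_one by simp
  have "?R (a \<otimes> b \<oplus> (\<ominus> a)) = ?R (a \<otimes> b) \<circ> ?R (\<ominus> a)"
    using a b by (simp add: R minus_closed)
  also have "\<dots> = ?A \<circ> ?R b \<circ> inv_into UNIV ?A \<circ> (?R a \<circ> ?R (\<ominus> a))"
    using twisted_rel[OF a b] by (simp add: alg_mult_basis comp_assoc)
  also have "\<dots> = ?A \<circ> ?R b \<circ> inv_into UNIV ?A"
    using a by (simp add: R R0 plus_simps)
  finally show ?thesis
    by (simp add: comp_assoc inv)
qed

definition semidirect_action :: "'b \<times> 'b \<Rightarrow> 'v \<Rightarrow> 'v" where
  "semidirect_action = (\<lambda>(k, c). \<rho> (alg_basis (k \<oplus> (\<ominus> c))) \<circ> \<beta> (alg_basis c))"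

lemma semidirect_action_mult:
  assumes "k \<in> carrier B" "c \<in> carrier B" "l \<in> carrier B" "d \<in> carrier B"
  shows "semidirect_action (k \<oplus> brace_lambda B c l, c \<otimes> d)
    = semidirect_action (k, c) \<circ> semidirect_action (l, d)"
proof -
  let ?R = "\<lambda>x. \<rho> (alg_basis x)" and ?A = "\<lambda>x. \<beta> (alg_basis x)"
  have R: "?R x \<circ> ?R y = ?R (x \<oplus> y)" if "x \<in> carrier B" "y \<in> carrier B" for x y
    using \<rho>.basis_mult[of x y] that by simp
  have "semidirect_action (k, c) \<circ> semidirect_action (l, d)
      = ?R (k \<oplus> (\<ominus> c)) \<circ> (?A c \<circ> ?R (l \<oplus> (\<ominus> d))) \<circ> ?A d"
    by (simp add: semidirect_action_def comp_assoc)
  \<comment> \<open>Moving \<beta>(c) to the right past \<rho>(l - d) turns the index into c(l - d)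
    - c, which is cl - cd by \<open>mult_minus\<close>.\<close>
  also have "\<dots> = ?R (k \<oplus> (\<ominus> c)) \<circ> ?R (c \<otimes> l \<oplus> (\<ominus> (c \<otimes> d))) \<circ> (?A c \<circ> ?A d)"
    using assms by (simp add: beta_rho mult_minus plus_closed minus_closed comp_assoc)
  also have "\<dots> = ?R (k \<oplus> (\<ominus> c) \<oplus> (c \<otimes> l \<oplus> (\<ominus> (c \<otimes> d)))) \<circ> ?A (c \<otimes> d)"
    using assms by (simp add: R \<beta>.basis_mult plus_closed minus_closed)
  \<comment> \<open>The summands -c + cl inside k - c + cl - cd are exactly \<lambda>_c(l), so the
    index is the first component of the product minus its second component cd.\<close>
  finally show ?thesis
    using assms by (simp add: semidirect_action_def brace_lambda_def plus_simps)
qed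

lemma linear_group_action_semidirect:
  "linear_group_action (brace_semidirect B) scale semidirect_action"
proof -
  have bij: "bij (semidirect_action (k, c))" if "k \<in> carrier B" "c \<in> carrier B" for k c
    using that \<rho>.basis_bij[OF add.is_group, of "k \<oplus> (\<ominus> c)"] \<beta>.basis_bij[OF mult.is_group, of c]
    by (auto simp: semidirect_action_def plus_closed minus_closed intro: bij_comp)
  have "semidirect_action \<in> hom (brace_semidirect B) (BijGroup UNIV)"
    \<comment> \<open>Multiplication in \<open>BijGroup UNIV\<close> is composition restricted to
      bijections, so \<open>bij\<close> is needed for the product formula as well as for
      membership.\<close>
    by (rule homI)
       (auto simp: brace_semidirect_def semidirect_product_def BijGroup_def Bij_def bij
         semidirect_action_mult compose_eq brace_lambda_closed plus_closed fun_eq_iff compose_def)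
  then have "group_action (brace_semidirect B) UNIV semidirect_action"
    by (simp add: group_action_def group_hom_def group_hom_axioms_def group_brace_semidirect
        group_BijGroup)
  moreover have "Vector_Spaces.linear scale scale (semidirect_action g)"
    if "g \<in> carrier (brace_semidirect B)" for g
    using that \<rho>.basis_linear \<beta>.basis_linear
    by (auto simp: semidirect_action_def brace_semidirect_def semidirect_product_def
        plus_closed minus_closed intro!: Vector_Spaces.linear_compose)
  ultimately show ?thesis
    by (simp add: linear_group_action_def \<rho>.vector_space_axioms)
qed

text \<open>Since 1 = 0, the pair (k, 1) acts by \<rho>(k) \<beta>(1) = \<rho>(k), and (c, c) acts
  by \<rho>(0) \<beta>(c) = \<beta>(c).\<close>

lemma encodes_brace_module_semidirect: "encodes_brace_module B semidirect_action \<rho> \<beta>"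
  using \<rho>.hom_one \<beta>.hom_one
  by (simp add: encodes_brace_module_def semidirect_action_def minus_one plus_simps)

end

theorem proposition5p11:
  fixes B :: "('b, 'm) ring_scheme"
    and scale :: "complex \<Rightarrow> 'v::ab_group_add \<Rightarrow> 'v"
    and \<rho> \<beta> :: "('b \<Rightarrow>\<^sub>0 complex) \<Rightarrow> 'v \<Rightarrow> 'v"
  assumes "skew_left_brace B"
    and "finite (carrier B)"
    and "twisted_brace_module B scale \<rho> \<beta>"
  shows "\<exists>\<sigma>. linear_group_action (brace_semidirect B) scale \<sigma> \<and> encodes_brace_module B \<sigma> \<rho> \<beta>"
proof -
  interpret twisted_brace_module B scale \<rho> \<beta> by fact
  show ?thesis
    using linear_group_action_semidirect encodes_brace_module_semidirect by blast
qed

end
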